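(* Let $\mathcal D$ be a $3-(2v,k,\Theta)$ design obtained by Construction I with $\Theta-\Delta=0$ (respectively, a $3-(2v,k,\Theta^* )$ design obtained by Construction II with $\Theta^*-\Delta^*=0$), with both constructions and all notation as defined in the context. For Construction I put $\tau_h=u_hb^{(n+h)}+u_{n+h}b^{(h)}$ for $h=1,\ldots,n$; for Construction II put $\tau_h=u_hb^{(n+h)}+u_{n+h}b^{(h)}$ for $h=1,\ldots,n-1$ and $\tau_n=u_nb^{(n)}$. Assume that there exist positive integers $m_1,\ldots,m_n$ with $m_h\mid z_hw_h$ for $h=1,\ldots,n$ such that $m_1\tau_1=\cdots=m_n\tau_n=:\sigma$. Then $\mathcal D$ is $(1,\sigma)$-resolvable.
   Context: A $t-(v,k,\lambda)$ design is a pair $(X,\mathcal B)$ with $|X|=v$ and $\mathcal B$ a finite collection (multiset) of $k$-subsets (blocks) of $X$ such that every $t$-subset of $X$ lies in exactly $\lambda$ blocks; it is simple if no block is repeated. A $(1,\sigma)$-resolution of a design with point set $X$, $|X|=v$, and block size $k$ is a partition of its collection of blocks into $w\ge 2$ classes (resolution classes), each of which is a $1-(v,k,\sigma)$ design on $X$; a design is $(1,\sigma)$-resolvable if it has a $(1,\sigma)$-resolution. Ingredients. Let $n\ge1$ and let $k_1,\ldots,k_{2n},k$ be integers with $2\le k_1<\cdots<k_n\le k/2$ and $k_i+k_{n+i}=k$ ($1\le i\le n$). For $j=1,\ldots,2n$ let $D_j$ be a $3-(v,k_j,\lambda^{(j)})$ design on a common $v$-set $X$ with a $(1,\sigma^{(j)})$-resolution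 into $w_j$ classes listed as $\pi^{(j)}_1,\ldots,\pi^{(j)}_{w_j}$, with $w_i=w_{n+i}$ for $1\le i\le n$. At least one of $D_i,D_{n+i}$ is simple for each $i\le n$; a non-simple $D_j$ is a union of $a_j$ copies of a simple $3$-design $C_j$ having a $(1,\sigma^{(j)})$-resolution with $t_j$ classes, and the list of classes of $D_j$ is that of $C_j$ repeated $a_j$ times in succession ($w_j=a_jt_j$). For $k_j=2$, a union of copies of the complete design of all pairs is regarded as a $3-(v,2,0)$ design. Put $u_j=\sigma^{(j)}$, $b^{(j)}=\sigma^{(j)}v/k_j$ (the number of blocks in each class), and let $\lambda^{(j)}_2$ be the number of blocks of $D_j$ through two given points. For indices $i,j\in\{1,\ldots,w_h\}$ let $d^{(h)}(i,j)=\min\{|i-j|,w_h-|i-j|\}$. For each $h\le n$ fix $\varepsilon_h\in\{0,1\}$ and an integer $s_h$ with $\varepsilon_h\le s_h\le w_h/2$, and let $z_h=2s_h+1-\varepsilon_h$ if $s_h<w_h/2$ and $z_h=2s_h-\varepsilon_h$ if $s_h=w_h/2$ (so $z_hw_h$ is the number of ordered pairs $(i,j)$ with $\varepsilon_h\le d^{(h)}(i,j)\le s_h$); it is required that $1\le z_h\le w_h$ if $D_h$ and $D_{n+h}$ are both simple, and $1\le z_h\le t_j$ if $D_j$ is non-simple, $j\in\{h,n+h\}$. Let $\tilde X$ be a disjoint copy of $X$, and write $\tilde A,\tilde\pi$ for the copies on $\tilde X$ of a block $A$ or class $\pi$. Construction I ($k_n<k/2$), in the case $\Theta-\Delta=0$: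 the blocks on $X\cup\tilde X$ are all $A\cup\tilde B$ with $A\in\pi^{(h)}_i$, $\tilde B\in\tilde\pi^{(n+h)}_j$, and all $\tilde A\cup B$ with $\tilde A\in\tilde\pi^{(h)}_i$, $B\in\pi^{(n+h)}_j$, for $1\le h\le n$ and all $(i,j)$ with $\varepsilon_h\le d^{(h)}(i,j)\le s_h$. Here $\Theta=\sum_{h=1}^n(\lambda_2^{(h)}u_{n+h}+\lambda_2^{(n+h)}u_h)z_h$ and $\Delta=\sum_{h=1}^n(\lambda^{(h)}b^{(n+h)}+\lambda^{(n+h)}b^{(h)})z_h$. Construction II ($k_n=k/2$, $D_n=D_{2n}$ simple, with the same resolution), in the case $\Theta^*-\Delta^*=0$: the blocks are those of both kinds above for $1\le h\le n-1$, together with all $A\cup\tilde B$ with $A\in\pi^{(n)}_i$, $\tilde B\in\tilde\pi^{(n)}_j$, $\varepsilon_n\le d^{(n)}(i,j)\le s_n$. Here $\Theta^*=\lambda_2^{(n)}u_nz_n+\sum_{h=1}^{n-1}(\lambda_2^{(h)}u_{n+h}+\lambda_2^{(n+h)}u_h)z_h$ and $\Delta^*=\lambda^{(n)}b^{(n)}z_n+\sum_{h=1}^{n-1}(\lambda^{(h)}b^{(n+h)}+\lambda^{(n+h)}b^{(h)})z_h$.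
   Formalization: The case n = 1 with m_1 = z_1 w_1 is excluded: there σ equals the replication number of the whole design, so no resolution into at least two classes, as the definition requires, can exist. *)

theory Defs
  imports Main "HOL-Library.Multiset"
begin

definition design :: "nat \<Rightarrow> nat \<Rightarrow> nat \<Rightarrow> nat \<Rightarrow> 'a set \<Rightarrow> 'a set multiset \<Rightarrow> bool" where
  "design t v k l X Bs \<longleftrightarrow>
     finite X \<and> card X = v \<and>
     (\<forall>A \<in># Bs. A \<subseteq> X \<and> card A = k) \<and>
     (\<forall>T. T \<subseteq> X \<and> card T = t \<longrightarrow> size {#A \<in># Bs. T \<subseteq> A#} = l)"

definition simple :: "'a set multiset \<Rightarrow> bool" where
  "simple Bs \<longleftrightarrow> (\<forall>A. count Bs A \<le> 1)"

(* For k = 2 only a union of copies of the complete design of all pairs counts as a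
   3-(v,2,0) design; the bare definition would accept every collection of pairs. *)
definition three_design :: "nat \<Rightarrow> nat \<Rightarrow> nat \<Rightarrow> 'a set \<Rightarrow> 'a set multiset \<Rightarrow> bool" where
  "three_design v k l X Bs \<longleftrightarrow>
     (if k = 2 then finite X \<and> card X = v \<and> l = 0 \<and>
        (\<exists>c\<ge>1. Bs = repeat_mset c (mset_set {P. P \<subseteq> X \<and> card P = 2}))
      else design 3 v k l X Bs)"

(* The classes come as a list because the constructions depend on their order.
   The classes of a partition are nonempty. *)
definition one_resolution ::
    "nat \<Rightarrow> nat \<Rightarrow> nat \<Rightarrow> 'a set \<Rightarrow> 'a set multiset \<Rightarrow> 'a set multiset list \<Rightarrow> bool" where
  "one_resolution v k s X Bs cs \<longleftrightarrow>
     length cs \<ge> 2 \<and> sum_list cs = Bs \<and>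
     (\<forall>c \<in> set cs. c \<noteq> {#} \<and> design 1 v k s X c)"

definition one_resolvable :: "nat \<Rightarrow> nat \<Rightarrow> nat \<Rightarrow> 'a set \<Rightarrow> 'a set multiset \<Rightarrow> bool" where
  "one_resolvable v k s X Bs \<longleftrightarrow> (\<exists>cs. one_resolution v k s X Bs cs)"

(* Number of blocks of a 1-(v,k,s) design. The division is exact for k > 0,
   see design_1_size below. *)
definition class_size :: "nat \<Rightarrow> nat \<Rightarrow> nat \<Rightarrow> nat" where
  "class_size v k s = s * v div k"

lemma design_1_size:
  assumes "design 1 v k s X Bs"
  shows "size Bs * k = s * v"
proof -
  have fin: "finite X" and cX: "card X = v"
    and blk: "\<forall>A \<in># Bs. A \<subseteq> X \<and> card A = k"
    and reg: "\<And>T. T \<subseteq> X \<Longrightarrow> card T = 1 \<Longrightarrow> size {#A \<in># Bs. T \<subseteq> A#} = s"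
    using assms by (auto simp: design_def)
  have "(\<Sum>x\<in>X. size {#A \<in># Bs. x \<in> A#}) = size Bs * k"
    using blk
  proof (induction Bs)
    case empty
    then show ?case by simp
  next
    case (add A Bs)
    have "size {#B \<in># add_mset A Bs. x \<in> B#} =
        (if x \<in> A then 1 else 0) + size {#B \<in># Bs. x \<in> B#}" for x
      by simp
    then have "(\<Sum>x\<in>X. size {#B \<in># add_mset A Bs. x \<in> B#}) =
        (\<Sum>x\<in>X. if x \<in> A then 1 else 0) + size Bs * k"
      using add by (simp add: sum.distrib)
    also have "(\<Sum>x\<in>X. if x \<in> A then 1 else (0::nat)) = card (X \<inter> A)"
      using fin by (simp add: sum.If_cases Int_def)
    also have "X \<inter> A = A"
      using add.prems by auto
    finally show ?case
      using add.prems by simp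
  qed
  moreover have "(\<Sum>x\<in>X. size {#A \<in># Bs. x \<in> A#}) = (\<Sum>x\<in>X. s)"
    using reg[of "{_}"] by (intro sum.cong) auto
  ultimately show ?thesis
    using cX by (simp add: mult.commute)
qed

definition cyc_dist :: "nat \<Rightarrow> nat \<Rightarrow> nat \<Rightarrow> nat" where
  "cyc_dist w i j = (let d = nat \<bar>int i - int j\<bar> in min d (w - d))"

(* List positions count from 0; cyc_dist depends on i - j only, so this agrees with
   counting the classes from 1. *)
definition near_pairs :: "nat \<Rightarrow> nat \<Rightarrow> nat \<Rightarrow> (nat \<times> nat) set" where
  "near_pairs w e s = {(i, j). i < w \<and> j < w \<and> e \<le> cyc_dist w i j \<and> cyc_dist w i j \<le> s}"

definition z_param :: "nat \<Rightarrow> nat \<Rightarrow> nat \<Rightarrow> nat" where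
  "z_param w e s = (if 2 * s < w then 2 * s + 1 - e else 2 * s - e)"

(* The point set X together with its disjoint copy is X <+> X (the copy on the right),
   and the union of A with the copy of B is A <+> B. *)
definition cross :: "'a set multiset \<Rightarrow> 'a set multiset \<Rightarrow> ('a + 'a) set multiset" where
  "cross P Q = (\<Sum>A \<in># P. {#A <+> B. B \<in># Q#})"

definition blocks_one_way ::
    "'a set multiset list \<Rightarrow> 'a set multiset list \<Rightarrow> nat \<Rightarrow> nat \<Rightarrow> ('a + 'a) set multiset" where
  "blocks_one_way ps qs e s =
     (\<Sum>(i, j) \<in> near_pairs (length ps) e s. cross (ps ! i) (qs ! j))"

definition blocks_both_ways ::
    "'a set multiset list \<Rightarrow> 'a set multiset list \<Rightarrow> nat \<Rightarrow> nat \<Rightarrow> ('a + 'a) set multiset" where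
  "blocks_both_ways ps qs e s =
     (\<Sum>(i, j) \<in> near_pairs (length ps) e s. cross (ps ! i) (qs ! j) + cross (qs ! j) (ps ! i))"

(* cls j is the list of classes of the j-th ingredient, j = 1, ..., 2n. *)
definition construction_I ::
    "nat \<Rightarrow> (nat \<Rightarrow> 'a set multiset list) \<Rightarrow> (nat \<Rightarrow> nat) \<Rightarrow> (nat \<Rightarrow> nat)
      \<Rightarrow> ('a + 'a) set multiset" where
  "construction_I n cls e s = (\<Sum>h=1..n. blocks_both_ways (cls h) (cls (n + h)) (e h) (s h))"

definition construction_II ::
    "nat \<Rightarrow> (nat \<Rightarrow> 'a set multiset list) \<Rightarrow> (nat \<Rightarrow> nat) \<Rightarrow> (nat \<Rightarrow> nat)
      \<Rightarrow> ('a + 'a) set multiset" where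
  "construction_II n cls e s =
     (\<Sum>h=1..<n. blocks_both_ways (cls h) (cls (n + h)) (e h) (s h))
     + blocks_one_way (cls n) (cls n) (e n) (s n)"

end

theory Submission
  imports Defs
begin

text \<open>
  For two resolution classes \<open>P\<close> and \<open>Q\<close>, every point of the left copy of \<open>X\<close> lies in
  \<open>u * size Q\<close> blocks \<open>A <+> B\<close> of \<open>cross P Q\<close>, and every point of the right copy in
  \<open>u' * size P\<close>, where \<open>u\<close> and \<open>u'\<close> are the replication numbers of \<open>P\<close> and \<open>Q\<close>. So
  \<open>cross P Q + cross Q P\<close> is a \<open>1\<close>-design on the doubled point set with replication number
  \<open>u * size Q + u' * size P\<close>, and \<open>cross P Q\<close> alone is one when \<open>P\<close> and \<open>Q\<close> have the same
  parameters. This number is \<open>\<tau> h\<close> for every index pair used at \<open>h\<close>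
  (\<open>both_ways_cell\<close>, \<open>one_way_cell\<close>).

  For each \<open>h\<close> there are exactly \<open>z h * w h\<close> such pairs (\<open>card_near_pairs\<close>). As \<open>m h\<close> divides this
  number, the pairs fall into groups of \<open>m h\<close>, in any way whatever; the union of the
  \<open>1\<close>-designs in a group has replication number \<open>m h * \<tau> h = \<sigma>\<close> (\<open>group_into_classes\<close>).
  Since \<open>\<sigma>\<close> does not depend on \<open>h\<close>, the groups of all \<open>h\<close> together are a \<open>(1,\<sigma>)\<close>-resolution.

  A resolution must have two classes. Every \<open>h\<close> yields at least one, which suffices for
  \<open>n \<ge> 2\<close>; for \<open>n = 1\<close> there are \<open>z 1 * w 1 / m 1\<close> of them, and this quotient is not \<open>1\<close>.
\<close>

section \<open>Crossing two classes\<close>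

(* Rewriting 1 to Suc 0 inside design 1 would keep design_1_iff from matching. *)
declare One_nat_def [simp del]

lemma design_1_iff:
  "design 1 v k s X Bs \<longleftrightarrow>
     finite X \<and> card X = v \<and> (\<forall>A \<in># Bs. A \<subseteq> X \<and> card A = k) \<and>
     (\<forall>x\<in>X. size {#A \<in># Bs. x \<in> A#} = s)"
proof -
  have "(\<forall>T. T \<subseteq> X \<and> card T = 1 \<longrightarrow> size {#A \<in># Bs. T \<subseteq> A#} = s) \<longleftrightarrow>
      (\<forall>x\<in>X. size {#A \<in># Bs. x \<in> A#} = s)" (is "?sets \<longleftrightarrow> ?points")
  proof
    assume sets: ?sets
    show ?points
    proof
      fix x assume "x \<in> X"
      then have "size {#A \<in># Bs. {x} \<subseteq> A#} = s"
        by (intro sets[rule_format]) (simp add: One_nat_def)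
      moreover have "{#A \<in># Bs. {x} \<subseteq> A#} = {#A \<in># Bs. x \<in> A#}"
        by (rule filter_mset_cong) auto
      ultimately show "size {#A \<in># Bs. x \<in> A#} = s"
        by simp
    qed
  next
    assume ?points
    then show ?sets
      by (auto elim!: card_1_singletonE)
  qed
  then show ?thesis
    unfolding design_def by blast
qed

lemma cross_empty [simp]: "cross {#} Q = {#}"
  by (simp add: cross_def)

lemma cross_add_mset [simp]: "cross (add_mset A P) Q = {#A <+> B. B \<in># Q#} + cross P Q"
  by (simp add: cross_def)

lemma in_cross_iff: "Z \<in># cross P Q \<longleftrightarrow> (\<exists>A\<in>#P. \<exists>B\<in>#Q. Z = A <+> B)"
  by (induction P) auto

lemma size_filter_image_mset:
  "size {#y \<in># image_mset f M. R y#} = size {#x \<in># M. R (f x)#}"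
  by (induction M) auto

lemma Inl_in_Plus: "Inl x \<in> A <+> B \<longleftrightarrow> x \<in> A"
  and Inr_in_Plus: "Inr y \<in> A <+> B \<longleftrightarrow> y \<in> B"
  by auto

lemma degree_cross_left:
  "size {#Z \<in># cross P Q. Inl x \<in> Z#} = size {#A \<in># P. x \<in> A#} * size Q"
  by (induction P) (auto simp: size_filter_image_mset Inl_in_Plus)

lemma degree_cross_right:
  "size {#Z \<in># cross P Q. Inr x \<in> Z#} = size P * size {#B \<in># Q. x \<in> B#}"
  by (induction P) (auto simp: size_filter_image_mset Inr_in_Plus)

lemma cross_blocks:
  assumes "design 1 v k r X P" and "design 1 v l q X Q" and "Z \<in># cross P Q"
  shows "Z \<subseteq> X <+> X \<and> card Z = k + l"
proof -
  obtain A B where AB: "A \<in># P" "B \<in># Q" "Z = A <+> B"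
    using assms(3) by (auto simp: in_cross_iff)
  have "A \<subseteq> X" "B \<subseteq> X" "card A = k" "card B = l" "finite X"
    using assms(1,2) AB unfolding design_1_iff by auto
  then show ?thesis
    using AB(3) by (auto simp: card_Plus finite_subset)
qed

lemma size_eq_class_size:
  assumes "design 1 v k r X P" and "k > 0"
  shows "size P = class_size v k r"
  using design_1_size[OF assms(1)] assms(2)
  by (metis class_size_def nonzero_mult_div_cancel_right less_numeral_extra(3))

lemma cross_nonempty:
  assumes "P \<noteq> {#}" and "Q \<noteq> {#}"
  shows "cross P Q \<noteq> {#}"
  using assms by (metis in_cross_iff multiset_nonemptyE empty_iff set_mset_empty)

lemma card_doubled: "finite X \<Longrightarrow> card (X <+> X) = 2 * card X"
  by (simp add: card_Plus)

text \<open>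
  Swapping the roles of \<open>P\<close> and \<open>Q\<close> in the second summand equalises the degrees of the two
  copies of a point.
\<close>
lemma both_ways_cell:
  assumes P: "design 1 v k r X P" and Q: "design 1 v l q X Q" and "k > 0" "l > 0"
  shows "design 1 (2 * v) (k + l) (r * class_size v l q + q * class_size v k r) (X <+> X)
           (cross P Q + cross Q P)"
  using P Q cross_blocks[OF P Q] cross_blocks[OF Q P]
  by (auto simp: design_1_iff card_doubled degree_cross_left degree_cross_right
      size_eq_class_size[OF P \<open>k > 0\<close>] size_eq_class_size[OF Q \<open>l > 0\<close>] add.commute)

lemma one_way_cell:
  assumes P: "design 1 v k r X P" and Q: "design 1 v k r X Q" and "k > 0"
  shows "design 1 (2 * v) (2 * k) (r * class_size v k r) (X <+> X) (cross P Q)"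
  using P Q cross_blocks[OF P Q]
  by (auto simp: design_1_iff card_doubled degree_cross_left degree_cross_right
      size_eq_class_size[OF P \<open>k > 0\<close>] size_eq_class_size[OF Q \<open>k > 0\<close>])

section \<open>Counting the index pairs\<close>

text \<open>Cyclic distance is invariant under rotation, so \<open>i\<close> may be moved to \<open>0\<close>.\<close>
lemma card_near_row:
  assumes "i < w"
  shows "card {j. j < w \<and> e \<le> cyc_dist w i j \<and> cyc_dist w i j \<le> s}
       = card {d. d < w \<and> e \<le> min d (w - d) \<and> min d (w - d) \<le> s}"
proof -
  let ?rot = "\<lambda>d. if i + d < w then i + d else i + d - w"
  let ?unrot = "\<lambda>j. if i \<le> j then j - i else j + w - i"
  have rot: "?rot d < w" "cyc_dist w i (?rot d) = min d (w - d)" if "d < w" for d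
    using assms that by (auto simp: cyc_dist_def Let_def min_def)
  have unrot: "?unrot j < w" "?rot (?unrot j) = j" if "j < w" for j
    using assms that by auto
  have "bij_betw ?rot {d. d < w \<and> e \<le> min d (w - d) \<and> min d (w - d) \<le> s}
      {j. j < w \<and> e \<le> cyc_dist w i j \<and> cyc_dist w i j \<le> s}"
  proof (rule bij_betw_byWitness[where f' = ?unrot])
    show "\<forall>d\<in>{d. d < w \<and> e \<le> min d (w - d) \<and> min d (w - d) \<le> s}. ?unrot (?rot d) = d"
      using assms by auto
    show "\<forall>j\<in>{j. j < w \<and> e \<le> cyc_dist w i j \<and> cyc_dist w i j \<le> s}. ?rot (?unrot j) = j"
      using unrot by blast
    show "?rot ` {d. d < w \<and> e \<le> min d (w - d) \<and> min d (w - d) \<le> s}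
        \<subseteq> {j. j < w \<and> e \<le> cyc_dist w i j \<and> cyc_dist w i j \<le> s}"
    proof safe
      fix d assume d: "d < w" "e \<le> min d (w - d)" "min d (w - d) \<le> s"
      show "?rot d < w" "e \<le> cyc_dist w i (?rot d)" "cyc_dist w i (?rot d) \<le> s"
        using d(2,3) unfolding rot(2)[OF d(1)] using rot(1)[OF d(1)] by (simp_all only:)
    qed
    show "?unrot ` {j. j < w \<and> e \<le> cyc_dist w i j \<and> cyc_dist w i j \<le> s}
        \<subseteq> {d. d < w \<and> e \<le> min d (w - d) \<and> min d (w - d) \<le> s}"
    proof safe
      fix j assume j: "j < w" "e \<le> cyc_dist w i j" "cyc_dist w i j \<le> s"
      have "cyc_dist w i j = min (?unrot j) (w - ?unrot j)"
        using rot(2)[OF unrot(1)[OF j(1)]] unfolding unrot(2)[OF j(1)] .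
      with j show "?unrot j < w" "e \<le> min (?unrot j) (w - ?unrot j)"
          "min (?unrot j) (w - ?unrot j) \<le> s"
        using unrot(1)[OF j(1)] by (simp_all only:)
    qed
  qed
  then show ?thesis
    by (rule bij_betw_same_card[symmetric])
qed

text \<open>
  For \<open>2 * s < w\<close> the offsets lie in two disjoint intervals, at the start and at the end of the
  cycle; for \<open>2 * s = w\<close> these meet in \<open>s\<close>, and every offset from \<open>e\<close> on is admitted.
\<close>
lemma card_near_offsets:
  assumes "e \<le> 1" and "e \<le> s" and "2 * s \<le> w" and "w > 0"
  shows "card {d. d < w \<and> e \<le> min d (w - d) \<and> min d (w - d) \<le> s} = z_param w e s"
proof (cases "2 * s < w")
  case True
  have "{d. d < w \<and> e \<le> min d (w - d) \<and> min d (w - d) \<le> s} = {e..s} \<union> {w - s..<w}"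
    using assms True by (auto simp: min_def split: if_splits)
  moreover have "card ({e..s} \<union> {w - s..<w}) = card {e..s} + card {w - s..<w}"
    using True by (intro card_Un_disjoint) auto
  ultimately show ?thesis
    using True assms by (simp add: z_param_def)
next
  case False
  then have "{d. d < w \<and> e \<le> min d (w - d) \<and> min d (w - d) \<le> s} = {e..<w}"
    using assms by (auto simp: min_def)
  then show ?thesis
    using False assms by (simp add: z_param_def)
qed

lemma near_pairs_Sigma:
  "near_pairs w e s =
     (SIGMA i:{..<w}. {j. j < w \<and> e \<le> cyc_dist w i j \<and> cyc_dist w i j \<le> s})"
  by (auto simp: near_pairs_def)

lemma finite_near_pairs: "finite (near_pairs w e s)"
  by (rule finite_subset[of _ "{..<w} \<times> {..<w}"]) (auto simp: near_pairs_def)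

lemma card_near_pairs:
  assumes "e \<le> 1" and "e \<le> s" and "2 * s \<le> w" and "w > 0"
  shows "card (near_pairs w e s) = z_param w e s * w"
proof -
  have "card (near_pairs w e s)
      = (\<Sum>i<w. card {j. j < w \<and> e \<le> cyc_dist w i j \<and> cyc_dist w i j \<le> s})"
    by (simp add: near_pairs_Sigma)
  also have "\<dots> = (\<Sum>i<w. z_param w e s)"
    by (intro sum.cong refl trans[OF card_near_row card_near_offsets[OF assms]]) simp
  finally show ?thesis
    by simp
qed

section \<open>Grouping cells into resolution classes\<close>

text \<open>
  A \<open>(1,r)\<close>-resolution with a prescribed number \<open>q\<close> of classes, where \<open>q\<close> may be less than \<open>2\<close>:
  the blocks arising from a single index \<open>h\<close> may form one class only.
\<close>
definition partial_resolution ::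
    "nat \<Rightarrow> nat \<Rightarrow> nat \<Rightarrow> 'a set \<Rightarrow> nat \<Rightarrow> 'a set multiset \<Rightarrow> 'a set multiset list \<Rightarrow> bool" where
  "partial_resolution v k r X q Bs cs \<longleftrightarrow>
     length cs = q \<and> sum_list cs = Bs \<and> (\<forall>c \<in> set cs. c \<noteq> {#} \<and> design 1 v k r X c)"

lemma degree_sum:
  "finite S \<Longrightarrow> size {#A \<in># (\<Sum>p\<in>S. f p). x \<in> A#} = (\<Sum>p\<in>S. size {#A \<in># f p. x \<in> A#})"
  by (induction S rule: finite_induct) auto

lemma design_1_sum:
  assumes "finite S" and "S \<noteq> {}" and "\<And>p. p \<in> S \<Longrightarrow> design 1 v k r X (f p)"
  shows "design 1 v k (card S * r) X (\<Sum>p\<in>S. f p)"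
proof -
  obtain p where "p \<in> S"
    using assms(2) by blast
  then have "finite X" "card X = v"
    using assms(3) by (auto simp: design_1_iff)
  moreover have "A \<subseteq> X \<and> card A = k" if "A \<in># (\<Sum>p\<in>S. f p)" for A
    using that assms(1,3) by (auto simp: set_mset_sum design_1_iff)
  moreover have "size {#A \<in># (\<Sum>p\<in>S. f p). x \<in> A#} = card S * r" if "x \<in> X" for x
    using that assms(1,3) by (simp add: degree_sum design_1_iff)
  ultimately show ?thesis
    by (simp add: design_1_iff)
qed

text \<open>
  Any \<open>m\<close> cells form a class, since replication numbers add; so \<open>m\<close> cells at a time are split
  off until none is left.
\<close>
lemma group_into_classes:
  assumes "finite S" and "card S = q * m" and "m > 0"
    and "\<And>p. p \<in> S \<Longrightarrow> f p \<noteq> {#} \<and> design 1 v k r X (f p)"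
  shows "\<exists>cs. partial_resolution v k (m * r) X q (\<Sum>p\<in>S. f p) cs"
  using assms(1,2,4)
proof (induction q arbitrary: S)
  case 0
  then show ?case by (simp add: partial_resolution_def)
next
  case (Suc q)
  obtain T where T: "T \<subseteq> S" "card T = m" "finite T"
    using obtain_subset_with_card_n[of m S] Suc.prems(2) by auto
  have "card (S - T) = q * m"
    using T Suc.prems by (simp add: card_Diff_subset)
  then obtain cs where cs: "partial_resolution v k (m * r) X q (\<Sum>p\<in>S - T. f p) cs"
    using Suc.IH[of "S - T"] Suc.prems by auto
  have "T \<noteq> {}"
    using T(2) assms(3) by auto
  have "design 1 v k (m * r) X (\<Sum>p\<in>T. f p)"
    using design_1_sum[OF T(3) \<open>T \<noteq> {}\<close>, of v k r X f] T Suc.prems(3) by auto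
  moreover have "(\<Sum>p\<in>T. f p) \<noteq> {#}"
    using T \<open>T \<noteq> {}\<close> Suc.prems(3) by (auto simp: sum_eq_empty_iff)
  moreover have "(\<Sum>p\<in>S. f p) = (\<Sum>p\<in>T. f p) + (\<Sum>p\<in>S - T. f p)"
    using sum.subset_diff[OF T(1) Suc.prems(1), of f] by (simp add: add.commute)
  ultimately have "partial_resolution v k (m * r) X (Suc q) (\<Sum>p\<in>S. f p) ((\<Sum>p\<in>T. f p) # cs)"
    using cs by (simp add: partial_resolution_def)
  then show ?case ..
qed

lemma partial_resolution_append:
  assumes "partial_resolution v k r X p As cs" and "partial_resolution v k r X q Bs ds"
  shows "partial_resolution v k r X (p + q) (As + Bs) (cs @ ds)"
  using assms by (auto simp: partial_resolution_def)

lemma partial_resolution_sum: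
  assumes "finite I" and "\<And>h. h \<in> I \<Longrightarrow> \<exists>cs. partial_resolution v k r X (q h) (Bs h) cs"
  shows "\<exists>cs. partial_resolution v k r X (\<Sum>h\<in>I. q h) (\<Sum>h\<in>I. Bs h) cs"
  using assms
proof (induction I rule: finite_induct)
  case empty
  then show ?case by (simp add: partial_resolution_def)
next
  case (insert h I)
  then obtain cs ds where "partial_resolution v k r X (q h) (Bs h) cs"
      "partial_resolution v k r X (\<Sum>h\<in>I. q h) (\<Sum>h\<in>I. Bs h) ds"
    by (metis insertCI)
  from partial_resolution_append[OF this] show ?case
    using insert.hyps by auto
qed

lemma one_resolvable_if_partial_resolution:
  assumes "\<exists>cs. partial_resolution v k r X q Bs cs" and "q \<ge> 2"
  shows "one_resolvable v k r X Bs"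
  using assms by (auto simp: one_resolvable_def one_resolution_def partial_resolution_def)

lemma blocks_both_ways_resolution:
  assumes ps: "\<forall>c\<in>set ps. c \<noteq> {#} \<and> design 1 v k r X c"
    and qs: "\<forall>c\<in>set qs. c \<noteq> {#} \<and> design 1 v l q X c"
    and "length qs = length ps" and "k > 0" "l > 0" and "m > 0"
    and "card (near_pairs (length ps) e s) = N * m"
  shows "\<exists>cs. partial_resolution (2 * v) (k + l)
           (m * (r * class_size v l q + q * class_size v k r)) (X <+> X) N
           (blocks_both_ways ps qs e s) cs"
proof -
  have cell: "ps ! i \<noteq> {#}" "design 1 v k r X (ps ! i)" "qs ! j \<noteq> {#}" "design 1 v l q X (qs ! j)"
    if "(i, j) \<in> near_pairs (length ps) e s" for i j
    using that assms(1-3) by (auto simp: near_pairs_def)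
  show ?thesis
    unfolding blocks_both_ways_def
    by (rule group_into_classes[OF finite_near_pairs assms(7,6)])
      (use cell in \<open>auto simp: cross_nonempty intro!: both_ways_cell \<open>k > 0\<close> \<open>l > 0\<close>\<close>)
qed

lemma blocks_one_way_resolution:
  assumes ps: "\<forall>c\<in>set ps. c \<noteq> {#} \<and> design 1 v k r X c" and "k > 0" and "m > 0"
    and "card (near_pairs (length ps) e s) = N * m"
  shows "\<exists>cs. partial_resolution (2 * v) (2 * k) (m * (r * class_size v k r)) (X <+> X) N
           (blocks_one_way ps ps e s) cs"
proof -
  have cell: "ps ! i \<noteq> {#}" "design 1 v k r X (ps ! i)" "ps ! j \<noteq> {#}" "design 1 v k r X (ps ! j)"
    if "(i, j) \<in> near_pairs (length ps) e s" for i j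
    using that ps by (auto simp: near_pairs_def)
  show ?thesis
    unfolding blocks_one_way_def
    by (rule group_into_classes[OF finite_near_pairs assms(4,3)])
      (use cell in \<open>auto simp: cross_nonempty intro!: one_way_cell \<open>k > 0\<close>\<close>)
qed

section \<open>Resolvability of the constructed designs\<close>

theorem proposition3p9:
  fixes X :: "'a set" and v n k \<sigma> :: nat
    and kk lam lam2 u \<epsilon> s a t m :: "nat \<Rightarrow> nat"
    and D C :: "nat \<Rightarrow> 'a set multiset"
    and \<pi> \<rho> :: "nat \<Rightarrow> 'a set multiset list"
    and w b z :: "nat \<Rightarrow> nat"
    and \<D> :: "('a + 'a) set multiset"
  assumes "n \<ge> 1"
    and "2 \<le> kk 1" and "strict_mono_on {1..n} kk" and "2 * kk n \<le> k"
    and "\<forall>i\<in>{1..n}. kk i + kk (n + i) = k"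
    and "\<forall>j\<in>{1..2*n}. three_design v (kk j) (lam j) X (D j)"
    and "\<forall>j\<in>{1..2*n}. one_resolution v (kk j) (u j) X (D j) (\<pi> j)"
    and "\<forall>j\<in>{1..2*n}. w j = length (\<pi> j)"
    and "\<forall>i\<in>{1..n}. w i = w (n + i)"
    and "\<forall>i\<in>{1..n}. simple (D i) \<or> simple (D (n + i))"
    and "\<forall>j\<in>{1..2*n}. \<not> simple (D j) \<longrightarrow>
           simple (C j) \<and> (\<exists>l. three_design v (kk j) l X (C j)) \<and>
           one_resolution v (kk j) (u j) X (C j) (\<rho> j) \<and> t j = length (\<rho> j) \<and>
           D j = repeat_mset (a j) (C j) \<and> \<pi> j = concat (replicate (a j) (\<rho> j))"
    and "\<forall>j\<in>{1..2*n}. b j = class_size v (kk j) (u j)"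
    and "\<forall>j\<in>{1..2*n}. \<forall>x\<in>X. \<forall>y\<in>X. x \<noteq> y \<longrightarrow> size {#A \<in># D j. x \<in> A \<and> y \<in> A#} = lam2 j"
    and "\<forall>h\<in>{1..n}. \<epsilon> h \<in> {0, 1} \<and> \<epsilon> h \<le> s h \<and> 2 * s h \<le> w h"
    and "\<forall>h\<in>{1..n}. z h = z_param (w h) (\<epsilon> h) (s h)"
    and "\<forall>h\<in>{1..n}. simple (D h) \<and> simple (D (n + h)) \<longrightarrow> 1 \<le> z h \<and> z h \<le> w h"
    and "\<forall>h\<in>{1..n}. \<forall>j\<in>{h, n + h}. \<not> simple (D j) \<longrightarrow> 1 \<le> z h \<and> z h \<le> t j"
    and "\<forall>h\<in>{1..n}. 0 < m h \<and> m h dvd z h * w h"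
    and nontrivial: "n = 1 \<longrightarrow> m 1 \<noteq> z 1 * w 1"
  shows
    "(let \<Theta> = (\<Sum>h=1..n. (lam2 h * u (n + h) + lam2 (n + h) * u h) * z h);
          \<Delta> = (\<Sum>h=1..n. (lam h * b (n + h) + lam (n + h) * b h) * z h);
          \<tau> = (\<lambda>h. u h * b (n + h) + u (n + h) * b h)
      in 2 * kk n < k \<and>
         \<D> = construction_I n \<pi> \<epsilon> s \<and> design 3 (2 * v) k \<Theta> (X <+> X) \<D> \<and>
         \<Theta> = \<Delta> \<and> (\<forall>h\<in>{1..n}. m h * \<tau> h = \<sigma>)
         \<longrightarrow> one_resolvable (2 * v) k \<sigma> (X <+> X) \<D>)
     \<and>
     (let \<Theta>' = lam2 n * u n * z n
                + (\<Sum>h=1..<n. (lam2 h * u (n + h) + lam2 (n + h) * u h) * z h);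
          \<Delta>' = lam n * b n * z n
                + (\<Sum>h=1..<n. (lam h * b (n + h) + lam (n + h) * b h) * z h);
          \<tau> = (\<lambda>h. if h = n then u n * b n else u h * b (n + h) + u (n + h) * b h)
      in 2 * kk n = k \<and> simple (D n) \<and> D (2 * n) = D n \<and> \<pi> (2 * n) = \<pi> n \<and>
         \<D> = construction_II n \<pi> \<epsilon> s \<and> design 3 (2 * v) k \<Theta>' (X <+> X) \<D> \<and>
         \<Theta>' = \<Delta>' \<and> (\<forall>h\<in>{1..n}. m h * \<tau> h = \<sigma>)
         \<longrightarrow> one_resolvable (2 * v) k \<sigma> (X <+> X) \<D>)"
proof -
  define N where "N h = z h * w h div m h" for h
  have idx: "h \<in> {1..2*n}" "n + h \<in> {1..2*n}" if "h \<in> {1..n}" for h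
    using that by auto
  have kk_pos: "kk h > 0" "kk (n + h) > 0" and kk_sum: "kk h + kk (n + h) = k"
    if h: "h \<in> {1..n}" for h
  proof -
    have "kk 1 \<le> kk h" "kk h \<le> kk n"
      using strict_mono_on_leD[OF assms(3)] h assms(1) by auto
    moreover show "kk h + kk (n + h) = k"
      using assms(5) h by blast
    ultimately show "kk h > 0" "kk (n + h) > 0"
      using assms(2,4) by linarith+
  qed
  have classes: "\<forall>c\<in>set (\<pi> j). c \<noteq> {#} \<and> design 1 v (kk j) (u j) X c"
    and len: "length (\<pi> j) = w j" "w j \<ge> 2" and b: "b j = class_size v (kk j) (u j)"
    if "j \<in> {1..2*n}" for j
    using assms(7,8,12) that by (auto simp: one_resolution_def)
  have pairs: "card (near_pairs (length (\<pi> h)) (\<epsilon> h) (s h)) = N h * m h"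
    and N_pos: "N h \<ge> 1" and m_pos: "m h > 0"
    if h: "h \<in> {1..n}" for h
  proof -
    have w: "w h \<ge> 2" "length (\<pi> h) = w h"
      using len idx(1)[OF h] by auto
    have "m h dvd z h * w h"
      using assms(18) h by blast
    then have Nm: "N h * m h = z h * w h"
      by (simp add: N_def)
    have "\<epsilon> h \<le> 1" "\<epsilon> h \<le> s h" "2 * s h \<le> w h" "z h = z_param (w h) (\<epsilon> h) (s h)"
      using assms(14,15) h by force+
    then show "card (near_pairs (length (\<pi> h)) (\<epsilon> h) (s h)) = N h * m h"
      using card_near_pairs[of "\<epsilon> h" "s h" "w h"] w Nm by simp
    have "z h \<ge> 1"
      using assms(16,17) h by blast
    then have "N h * m h > 0"
      using Nm w by simp
    then show "N h \<ge> 1" "m h > 0"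
      by simp_all
  qed
  have N_total: "(\<Sum>h=1..n. N h) \<ge> 2"
  proof (cases "n = 1")
    case True
    have "N 1 * m 1 = z 1 * w 1"
      using assms(18) True by (simp add: N_def)
    then have "N 1 \<noteq> 1"
      using nontrivial True by auto
    moreover have "N 1 \<ge> 1"
      using N_pos True by simp
    ultimately show ?thesis
      using True by simp
  next
    case False
    have "(\<Sum>h=1..n. 1) \<le> (\<Sum>h=1..n. N h)"
      using N_pos by (intro sum_mono) auto
    then show ?thesis
      using False assms(1) by simp
  qed
  have both: "\<exists>cs. partial_resolution (2 * v) k \<sigma> (X <+> X) (N h)
      (blocks_both_ways (\<pi> h) (\<pi> (n + h)) (\<epsilon> h) (s h)) cs"
    if h: "h \<in> {1..n}" and \<sigma>: "m h * (u h * b (n + h) + u (n + h) * b h) = \<sigma>" for h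
  proof -
    have "length (\<pi> (n + h)) = length (\<pi> h)"
      using len(1)[OF idx(1)[OF h]] len(1)[OF idx(2)[OF h]] assms(9) h by simp
    from blocks_both_ways_resolution[OF classes[OF idx(1)[OF h]] classes[OF idx(2)[OF h]] this
        kk_pos[OF h] m_pos[OF h] pairs[OF h]]
    show ?thesis
      using \<sigma> kk_sum[OF h] by (simp add: b[OF idx(1)[OF h]] b[OF idx(2)[OF h]])
  qed
  have I: "one_resolvable (2 * v) k \<sigma> (X <+> X) (construction_I n \<pi> \<epsilon> s)"
    if "\<forall>h\<in>{1..n}. m h * (u h * b (n + h) + u (n + h) * b h) = \<sigma>"
  proof (rule one_resolvable_if_partial_resolution[OF _ N_total])
    show "\<exists>cs. partial_resolution (2 * v) k \<sigma> (X <+> X) (\<Sum>h=1..n. N h)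
        (construction_I n \<pi> \<epsilon> s) cs"
      unfolding construction_I_def
      by (rule partial_resolution_sum) (use that both in auto)
  qed
  have II: "one_resolvable (2 * v) k \<sigma> (X <+> X) (construction_II n \<pi> \<epsilon> s)"
    if k: "2 * kk n = k"
      and \<sigma>: "\<forall>h\<in>{1..n}. m h * (if h = n then u n * b n
                else u h * b (n + h) + u (n + h) * b h) = \<sigma>"
  proof (rule one_resolvable_if_partial_resolution[OF _ N_total])
    have n: "n \<in> {1..n}"
      using assms(1) by simp
    have both_sum: "\<exists>cs. partial_resolution (2 * v) k \<sigma> (X <+> X) (\<Sum>h=1..<n. N h)
        (\<Sum>h=1..<n. blocks_both_ways (\<pi> h) (\<pi> (n + h)) (\<epsilon> h) (s h)) cs"
    proof (rule partial_resolution_sum)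
      fix h assume "h \<in> {1..<n}"
      then have "h \<in> {1..n}" "h \<noteq> n"
        by auto
      then show "\<exists>cs. partial_resolution (2 * v) k \<sigma> (X <+> X) (N h)
          (blocks_both_ways (\<pi> h) (\<pi> (n + h)) (\<epsilon> h) (s h)) cs"
        using both[of h] \<sigma> by force
    qed simp
    have one_way: "\<exists>cs. partial_resolution (2 * v) k \<sigma> (X <+> X) (N n)
        (blocks_one_way (\<pi> n) (\<pi> n) (\<epsilon> n) (s n)) cs"
      using blocks_one_way_resolution[OF classes[OF idx(1)[OF n]] kk_pos(1)[OF n]
          m_pos[OF n] pairs[OF n]] k \<sigma>[rule_format, OF n] b[OF idx(1)[OF n]] by simp
    have "(\<Sum>h=1..n. N h) = (\<Sum>h=1..<n. N h) + N n"
      using assms(1) by (simp add: sum.last_plus add.commute)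
    then show "\<exists>cs. partial_resolution (2 * v) k \<sigma> (X <+> X) (\<Sum>h=1..n. N h)
        (construction_II n \<pi> \<epsilon> s) cs"
      unfolding construction_II_def
      using both_sum one_way by (auto intro: partial_resolution_append)
  qed
  show ?thesis
    unfolding Let_def
    by (intro conjI impI; elim conjE) (simp_all only: I II)
qed

end
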